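(* If $\mathcal{U}$ is an $[n,k]_{q^m/q}$ system with $n>2m-3$, then $\mathcal{U}$ is $2$-spannable.
   Context: Here $q$ is a prime power and $m,n,k$ are positive integers. An $[n,k]_{q^m/q}$ system is an $\mathbb{F}_q$-subspace $\mathcal{U}\subseteq\mathbb{F}_{q^m}^k$ of $\mathbb{F}_q$-dimension $n$ with $\langle\mathcal{U}\rangle_{\mathbb{F}_{q^m}}=\mathbb{F}_{q^m}^k$. It is $2$-spannable if there exist two $\mathbb{F}_{q^m}$-linear hyperplanes $\mathcal{H}_1,\mathcal{H}_2$ of $\mathbb{F}_{q^m}^k$ such that $\mathcal{U}=(\mathcal{H}_1\cap\mathcal{U})+(\mathcal{H}_2\cap\mathcal{U})$.
   Formalization: The formal theorem assumes k ≥ 2; for k = 1 the claim is false, since the only hyperplane of F_{q^m}^1 is {0} and a spanning U is not {0} (e.g. m = n = k = 1, U = F_q). *)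

theory Defs
  imports "HOL-Analysis.Analysis" "HOL-Number_Theory.Prime_Powers"
begin

text \<open>
  The extension of \<open>\<bbbF>\<^sub>q\<close> by \<open>\<bbbF>\<^bsub>q^m\<^esub>\<close> is modelled by two finite field types \<open>'f\<close> and \<open>'a\<close>
  with \<open>q\<close> and \<open>q ^ m\<close> elements and an embedding of the first into the second. The space of
  \<open>k\<close>-tuples over the large field is \<open>'a ^ 'k\<close> with \<open>k = CARD('k)\<close>; its linear algebra over
  \<open>'a\<close> is the library's \<open>vec\<close> interpretation.
\<close>

definition field_embedding :: "('f::field \<Rightarrow> 'a::field) \<Rightarrow> bool" where
  "field_embedding \<iota> \<longleftrightarrow>
     \<iota> 1 = 1 \<and> (\<forall>x y. \<iota> (x + y) = \<iota> x + \<iota> y) \<and> (\<forall>x y. \<iota> (x * y) = \<iota> x * \<iota> y)"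

definition restricted_scale :: "('f::field \<Rightarrow> 'a::field) \<Rightarrow> 'f \<Rightarrow> 'a ^ 'k \<Rightarrow> 'a ^ 'k" where
  "restricted_scale \<iota> c v = \<iota> c *s v"

lemma vector_space_restricted_scale:
  assumes "field_embedding \<iota>"
  shows "vector_space (restricted_scale \<iota> :: 'f::field \<Rightarrow> 'a::field ^ 'k \<Rightarrow> 'a ^ 'k)"
  using assms
  by unfold_locales
    (auto simp: field_embedding_def restricted_scale_def vec_eq_iff algebra_simps)

text \<open>
  An \<open>[n,k]\<close> system: linear over the small field with dimension \<open>n\<close> there, while the span is taken
  over the large field.
\<close>

definition rank_metric_system ::
    "('f::field \<Rightarrow> 'a::field) \<Rightarrow> nat \<Rightarrow> nat \<Rightarrow> ('a ^ 'k) set \<Rightarrow> bool" where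
  "rank_metric_system \<iota> n k U \<longleftrightarrow>
     CARD('k) = k \<and>
     module.subspace (restricted_scale \<iota>) U \<and>
     vector_space.dim (restricted_scale \<iota>) U = n \<and>
     vec.span U = UNIV"

definition linear_hyperplane :: "('a::field ^ 'k) set \<Rightarrow> bool" where
  "linear_hyperplane H \<longleftrightarrow> vec.subspace H \<and> vec.dim H + 1 = CARD('k)"

text \<open>
  Distinctness of the two hyperplanes is not demanded; it is automatic when \<open>U\<close> spans the
  whole space, since \<open>H\<^sub>1 = H\<^sub>2\<close> would put \<open>U\<close> inside a hyperplane. The sum is the elementwise
  sum of sets.
\<close>

definition two_spannable :: "('a::field ^ 'k) set \<Rightarrow> bool" where
  "two_spannable U \<longleftrightarrow>
     (\<exists>H\<^sub>1 H\<^sub>2. linear_hyperplane H\<^sub>1 \<and> linear_hyperplane H\<^sub>2 \<and> U = (H\<^sub>1 \<inter> U) + (H\<^sub>2 \<inter> U))"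

end

theory Submission
  imports Defs
begin

text \<open>
  Put \<open>Q = q ^ m\<close>, \<open>N = q ^ n\<close>, and identify a linear form with its coefficient vector.
  A nonzero vector is annihilated by a fraction \<open>1 / Q\<close> of all forms, so averaging twice gives two
  forms whose common kernel meets \<open>U\<close> in \<open>w\<close> points with \<open>(w - 1) Q\<^sup>2 \<le> N - 1\<close>. Since
  \<open>n \<ge> 2 m - 2\<close>, this implies \<open>w Q\<^sup>2 \<le> N q\<^sup>2\<close>. The bound survives enlarging the two forms to an
  independent pair \<open>(a, b)\<close>, and among such pairs \<open>h = |U \<inter> ker a|\<close> is taken maximal. Writing
  \<open>h\<^sub>c = |U \<inter> ker (b + c a)|\<close>, the pencil of hyperplanes through \<open>ker a \<inter> ker b\<close> gives
  \<open>N + Q w = h + \<Sum>c. h\<^sub>c\<close>. If \<open>h\<^sub>c Q \<ge> N q\<close> for some \<open>c\<close>, then \<open>h h\<^sub>c Q\<^sup>2 \<ge> N\<^sup>2 q\<^sup>2 \<ge> N w Q\<^sup>2\<close>. Otherwise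
  \<open>h\<^sub>c Q \<le> N\<close> for all \<open>c\<close>, all these numbers being powers of \<open>q\<close>, so \<open>h \<ge> Q w\<close>, while
  \<open>h\<^sub>c Q \<ge> N\<close> always. Either way \<open>h h\<^sub>c \<ge> N w\<close>, which is the size of \<open>U\<close> times that of the
  intersection of the two summands.
\<close>

section \<open>Cardinalities of finite subspaces and of sums of groups\<close>

lemma (in vector_space) card_span_independent:
  assumes "finite B" "independent B"
  shows "card (span B) = CARD('a) ^ card B"
  using assms
proof (induction B rule: finite_induct)
  case (insert b B)
  then have b: "b \<notin> span B" and B: "independent B"
    by (auto simp: independent_insert)
  have "bij_betw (\<lambda>(k, x). x + scale k b) (UNIV \<times> span B) (span (insert b B))"
    unfolding bij_betw_def
  proof
    \<comment> \<open>The coefficient of \<open>b\<close> is unique: otherwise a nonzero multiple of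
      \<open>b\<close>, and hence \<open>b\<close> itself, would lie in \<open>span B\<close>. So
      each new basis vector multiplies the size by the size of the scalar field.\<close>
    have eq: "k = l" if "x \<in> span B" "y \<in> span B" "x + scale k b = y + scale l b" for k l x y
    proof (rule ccontr)
      assume "k \<noteq> l"
      have "scale (k - l) b = y - x"
        using that(3) by (simp add: scale_left_diff_distrib algebra_simps)
      then have "scale (k - l) b \<in> span B"
        using that by (simp only: span_diff)
      then show False
        using b \<open>k \<noteq> l\<close> span_scale[of "scale (k - l) b" B "inverse (k - l)"] by simp
    qed
    show "inj_on (\<lambda>(k, x). x + scale k b) (UNIV \<times> span B)"
    proof (rule inj_onI, clarify)
      fix k l x y
      assume xy: "x \<in> span B" "y \<in> span B" "x + scale k b = y + scale l b"
      then have "k = l"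
        by (rule eq)
      with xy show "k = l \<and> x = y"
        by simp
    qed
    show "(\<lambda>(k, x). x + scale k b) ` (UNIV \<times> span B) = span (insert b B)"
    proof (intro equalityI subsetI)
      fix v assume "v \<in> span (insert b B)"
      then obtain k where "v - scale k b \<in> span B"
        by (auto simp: span_breakdown_eq)
      then show "v \<in> (\<lambda>(k, x). x + scale k b) ` (UNIV \<times> span B)"
        by (intro image_eqI[where x = "(k, v - scale k b)"]) auto
    next
      fix v assume "v \<in> (\<lambda>(k, x). x + scale k b) ` (UNIV \<times> span B)"
      then obtain k x where "x \<in> span B" "v = x + scale k b"
        by auto
      then have "v - scale k b \<in> span B"
        by simp
      then show "v \<in> span (insert b B)"
        unfolding span_breakdown_eq by (rule exI)
    qed
  qed
  then have "card (span (insert b B)) = card ((UNIV :: 'a set) \<times> span B)"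
    by (simp add: bij_betw_same_card)
  with insert B show ?case
    by (simp add: card_cartesian_product)
qed (simp add: card_1_singleton_iff)

lemma (in vector_space) card_subspace:
  assumes "finite S" "subspace S"
  shows "card S = CARD('a) ^ dim S"
proof -
  obtain B where B: "B \<subseteq> S" "independent B" "S \<subseteq> span B" "card B = dim S"
    by (rule basis_exists)
  have "card S = card (span B)"
    using span_subspace[OF B(1,3) assms(2)] by (rule arg_cong[OF sym])
  also have "\<dots> = CARD('a) ^ card B"
    using finite_subset[OF B(1) assms(1)] B(2) by (rule card_span_independent)
  finally show ?thesis
    by (simp only: B(4))
qed

text \<open>Each fibre of \<open>f\<close> in \<open>S\<close> over a value taken on
  \<open>S\<close> is a translate of the kernel, so all these fibres have the same size. Closure
  under differences makes a nonempty \<open>S\<close> a subgroup, which keeps the translates inside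
  \<open>S\<close>.\<close>

lemma card_eq_card_kernel_times_card_image:
  fixes f :: "'b::ab_group_add \<Rightarrow> 'c::ab_group_add"
  assumes "finite S" and diff: "\<And>x y. x \<in> S \<Longrightarrow> y \<in> S \<Longrightarrow> x - y \<in> S"
    and f: "\<And>x y. f (x + y) = f x + f y"
  shows "card S = card {x \<in> S. f x = 0} * card (f ` S)"
proof -
  have f0: "f 0 = 0"
    using f[of 0 0] by simp
  have fd: "f (x - y) = f x - f y" for x y
    using f[of "x - y" y] by simp
  have add: "x + y \<in> S" if "x \<in> S" "y \<in> S" for x y
  proof -
    have "(y - y) - y \<in> S"
      by (intro diff that)
    then have "x - ((y - y) - y) \<in> S"
      by (intro diff that)
    then show ?thesis
      by simp
  qed
  have "card {x \<in> S. f x = y} = card {x \<in> S. f x = 0}" if y: "y \<in> f ` S" for y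
  proof -
    obtain s where s: "s \<in> S" "y = f s"
      using y by blast
    have "bij_betw (\<lambda>x. x + s) {x \<in> S. f x = 0} {x \<in> S. f x = y}"
    proof (rule bij_betw_byWitness[where f' = "\<lambda>x. x - s"])
      show "(\<lambda>x. x + s) ` {x \<in> S. f x = 0} \<subseteq> {x \<in> S. f x = y}"
        using s by (auto simp: f intro: add)
      show "(\<lambda>x. x - s) ` {x \<in> S. f x = y} \<subseteq> {x \<in> S. f x = 0}"
        using s by (auto simp: fd intro: diff)
    qed auto
    then show ?thesis
      by (simp add: bij_betw_same_card)
  qed
  then have "(\<Sum>y\<in>f ` S. card {x \<in> S. f x = y}) = card {x \<in> S. f x = 0} * card (f ` S)"
    by simp
  then show ?thesis
    using sum.image_gen[OF \<open>finite S\<close>, of "\<lambda>_. 1::nat" f] by simp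
qed

text \<open>Addition maps \<open>A \<times> B\<close> onto \<open>A + B\<close>, and its kernel is
  the copy \<open>(x, - x)\<close> of \<open>A \<inter> B\<close>; the kernel-image count does the
  rest.\<close>

lemma card_set_plus_times_card_Int:
  fixes A B :: "'b::ab_group_add set"
  assumes "finite A" "finite B"
    and "\<And>x y. x \<in> A \<Longrightarrow> y \<in> A \<Longrightarrow> x - y \<in> A" "\<And>x y. x \<in> B \<Longrightarrow> y \<in> B \<Longrightarrow> x - y \<in> B"
  shows "card (A + B) * card (A \<inter> B) = card A * card B"
proof -
  have neg: "- x \<in> B" if "x \<in> B" for x
    using assms(4)[of "x - x" x] assms(4)[of x x] that by simp
  have "bij_betw (\<lambda>x. (x, - x)) (A \<inter> B) {p \<in> A \<times> B. fst p + snd p = 0}"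
  proof (rule bij_betw_byWitness[where f' = fst])
    show "\<forall>p\<in>{p \<in> A \<times> B. fst p + snd p = 0}. (fst p, - fst p) = p"
      by (auto simp: add_eq_0_iff)
    show "fst ` {p \<in> A \<times> B. fst p + snd p = 0} \<subseteq> A \<inter> B"
      using neg by (force simp: add_eq_0_iff2)
  qed (use neg in auto)
  then have "card (A \<inter> B) = card {p \<in> A \<times> B. fst p + snd p = 0}"
    by (simp add: bij_betw_same_card)
  moreover have "(\<lambda>p. fst p + snd p) ` (A \<times> B) = A + B"
    by (force simp: set_plus_def image_iff)
  moreover have "card (A \<times> B) = card {p \<in> A \<times> B. fst p + snd p = 0}
      * card ((\<lambda>p. fst p + snd p) ` (A \<times> B))"
    by (rule card_eq_card_kernel_times_card_image) (use assms in \<open>auto simp: add_ac\<close>)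
  ultimately show ?thesis
    by (simp only: card_cartesian_product mult.commute)
qed

section \<open>Linear forms and their kernels\<close>

definition dot :: "'a::field ^ 'k \<Rightarrow> 'a ^ 'k \<Rightarrow> 'a" where
  "dot a v = (\<Sum>i\<in>UNIV. a $ i * v $ i)"

lemma dot_add_left: "dot (a + b) v = dot a v + dot b v"
  and dot_add_right: "dot a (v + w) = dot a v + dot a w"
  and dot_diff_right: "dot a (v - w) = dot a v - dot a w"
  and dot_scale_left: "dot (c *s a) v = c * dot a v"
  and dot_scale_right: "dot a (c *s v) = c * dot a v"
  by (simp_all add: dot_def sum.distrib sum_subtractf sum_distrib_left algebra_simps)

lemma dot_zero_left [simp]: "dot 0 v = 0"
  and dot_zero_right [simp]: "dot a 0 = 0"
  by (simp_all add: dot_def)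

lemma dot_commute: "dot a v = dot v a"
  by (simp add: dot_def mult.commute)

lemma dot_axis: "dot a (axis i 1) = a $ i"
proof -
  have "dot a (axis i 1) = (\<Sum>j\<in>UNIV. if j = i then a $ j else 0)"
    unfolding dot_def by (rule sum.cong) (auto simp: axis_def)
  then show ?thesis
    by simp
qed

lemma ex_dot_eq_one:
  assumes "a \<noteq> 0"
  obtains v where "dot a v = 1"
proof -
  obtain i where "a $ i \<noteq> 0"
    using assms by (auto simp: vec_eq_iff)
  then have "dot a (inverse (a $ i) *s axis i 1) = 1"
    by (simp add: dot_scale_right dot_axis)
  then show thesis
    using that by blast
qed

text \<open>A vector \<open>e\<close> with \<open>dot a e = 1\<close> spans a complement of the
  kernel, since \<open>v - dot a v *s e\<close> is always annihilated. Adjoining \<open>e\<close>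
  therefore raises the dimension by one, to that of the whole space.\<close>

lemma linear_hyperplane_dot:
  fixes a :: "'a::field ^ 'k"
  assumes "a \<noteq> 0"
  shows "linear_hyperplane {v. dot a v = 0}" (is "linear_hyperplane ?H")
proof -
  have sub: "vec.subspace ?H"
    by (auto simp: vec.subspace_def dot_add_right dot_scale_right)
  obtain e where e: "dot a e = 1"
    using ex_dot_eq_one[OF assms] .
  have "v \<in> vec.span (insert e ?H)" for v
  proof -
    have "v - dot a v *s e \<in> ?H"
      by (simp add: dot_diff_right dot_scale_right e)
    from vec.span_base[OF this] show ?thesis
      by (auto simp: vec.span_breakdown_eq)
  qed
  then have "vec.dim (insert e ?H) = CARD('k)"
    by (metis UNIV_eq_I vec.dim_span vec_dim_card)
  moreover have "e \<notin> vec.span ?H"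
    using e sub by (simp add: vec.span_eq_iff[THEN iffD2])
  ultimately show ?thesis
    using sub by (simp add: linear_hyperplane_def vec.dim_insert)
qed

section \<open>Averaging over all linear forms\<close>

lemma card_annihilator:
  fixes u :: "'a::{field,finite} ^ 'k"
  assumes "u \<noteq> 0"
  shows "card {a. dot a u = 0} * CARD('a) = CARD('a ^ 'k)"
proof -
  obtain v where v: "dot u v = 1"
    using ex_dot_eq_one[OF assms] .
  have "y \<in> range (\<lambda>a. dot a u)" for y
    by (rule image_eqI[where x = "y *s v"]) (simp_all add: dot_scale_left dot_commute[of v] v)
  then have "range (\<lambda>a. dot a u) = UNIV"
    by blast
  then show ?thesis
    using card_eq_card_kernel_times_card_image[of UNIV "\<lambda>a. dot a u"]
    by (simp add: dot_add_left del: CARD_vec)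
qed

text \<open>Double counting of the pairs \<open>(a, u)\<close> with \<open>dot a u = 0\<close>: by
  \<open>card_annihilator\<close> the mean number of zeros in \<open>A\<close>, over all forms
  including the zero form, is \<open>card A\<close> divided by \<open>CARD('a)\<close>. Some form
  does not exceed the mean.\<close>

lemma ex_form_with_few_zeros:
  fixes A :: "('a::{field,finite} ^ 'k) set"
  assumes "0 \<notin> A"
  obtains a where "card {u \<in> A. dot a u = 0} * CARD('a) \<le> card A"
proof (rule ccontr)
  assume "\<not> thesis"
  then have *: "card A < card {u \<in> A. dot a u = 0} * CARD('a)" for a
    using that not_less by blast
  have "card A * CARD('a ^ 'k) = (\<Sum>a::'a ^ 'k\<in>UNIV. card A)"
    by (simp del: CARD_vec)
  also have "\<dots> < (\<Sum>a\<in>UNIV. card {u \<in> A. dot a u = 0} * CARD('a))"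
    by (rule sum_strict_mono) (use * in auto)
  also have "\<dots> = (\<Sum>a\<in>UNIV. \<Sum>u\<in>A. if dot a u = 0 then 1 else 0) * CARD('a)"
    by (simp add: sum_distrib_right sum.If_cases Int_def)
  also have "\<dots> = (\<Sum>u\<in>A. card {a. dot a u = 0} * CARD('a))"
    by (subst sum.swap) (simp add: sum_distrib_right sum.If_cases)
  also have "\<dots> = (\<Sum>u\<in>A. CARD('a ^ 'k))"
    by (rule sum.cong[OF refl], rule card_annihilator) (use assms in auto)
  finally show False
    by (simp del: CARD_vec)
qed

text \<open>The averaging is applied first to \<open>U - {0}\<close> and then to the zeros found
  there. The two subtractions of 1 discount the zero vector, which every form annihilates.\<close>

lemma ex_two_forms_with_few_zeros:
  fixes U :: "('a::{field,finite} ^ 'k) set"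
  assumes "0 \<in> U"
  obtains a b where
    "(card {u \<in> U. dot a u = 0 \<and> dot b u = 0} - 1) * CARD('a) ^ 2 \<le> card U - 1"
proof -
  obtain a where a: "card {u \<in> U - {0}. dot a u = 0} * CARD('a) \<le> card (U - {0})"
    using ex_form_with_few_zeros[of "U - {0}"] by auto
  obtain b where b: "card {u \<in> {u \<in> U - {0}. dot a u = 0}. dot b u = 0} * CARD('a)
      \<le> card {u \<in> U - {0}. dot a u = 0}"
    using ex_form_with_few_zeros[of "{u \<in> U - {0}. dot a u = 0}"] by auto
  have "{u \<in> {u \<in> U - {0}. dot a u = 0}. dot b u = 0} = {u \<in> U. dot a u = 0 \<and> dot b u = 0} - {0}"
    by auto
  moreover have "card ({u \<in> U. dot a u = 0 \<and> dot b u = 0} - {0})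
      = card {u \<in> U. dot a u = 0 \<and> dot b u = 0} - 1"
    using assms by (simp add: card_Diff_singleton)
  ultimately have "(card {u \<in> U. dot a u = 0 \<and> dot b u = 0} - 1) * CARD('a)
      \<le> card {u \<in> U - {0}. dot a u = 0}"
    using b by simp
  then have "(card {u \<in> U. dot a u = 0 \<and> dot b u = 0} - 1) * CARD('a) * CARD('a)
      \<le> card {u \<in> U - {0}. dot a u = 0} * CARD('a)"
    by simp
  also have "\<dots> \<le> card U - 1"
    using a assms by (simp add: card_Diff_singleton)
  finally show thesis
    using that by (simp add: power2_eq_square mult.assoc)
qed

section \<open>Independent pairs of forms and pencils of hyperplanes\<close>

text \<open>The forms obtained by averaging may be zero or proportional. An independent pair whose
  span contains both has a common kernel that is no larger.\<close>

lemma ex_independent_pair_spanning: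
  fixes a\<^sub>0 b\<^sub>0 :: "'a::field ^ 'k"
  assumes "CARD('k) \<ge> 2"
  obtains a b where "a \<noteq> 0" "b \<notin> vec.span {a}" "a\<^sub>0 \<in> vec.span {a, b}" "b\<^sub>0 \<in> vec.span {a, b}"
proof -
  obtain a where a: "a \<noteq> 0" "a\<^sub>0 \<in> vec.span {a}"
  proof (cases "a\<^sub>0 = 0")
    case True
    moreover have "axis undefined 1 \<noteq> (0 :: 'a ^ 'k)"
      by (simp add: axis_eq_0_iff)
    ultimately show thesis
      using that vec.span_zero by metis
  next
    case False
    then show thesis
      by (rule that) (simp add: vec.span_base)
  qed
  have "vec.span {a} \<noteq> UNIV"
  proof
    assume "vec.span {a} = UNIV"
    then have "vec.dim (UNIV :: ('a ^ 'k) set) = vec.dim {a}"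
      by (metis vec.dim_span)
    then show False
      using assms a unfolding vec_dim_card by simp
  qed
  then obtain c where c: "c \<notin> vec.span {a}"
    by blast
  define b where "b = (if b\<^sub>0 \<in> vec.span {a} then c else b\<^sub>0)"
  have "vec.span {a} \<subseteq> vec.span {a, b}"
    by (rule vec.span_mono) auto
  moreover have "b\<^sub>0 \<in> vec.span {a} \<or> b\<^sub>0 = b"
    by (simp add: b_def)
  moreover have "b \<in> vec.span {a, b}"
    by (simp add: vec.span_base)
  moreover have "b \<notin> vec.span {a}"
    using c by (simp add: b_def)
  ultimately show thesis
    using that a by blast
qed

lemma dot_eq_0_of_span:
  assumes "c \<in> vec.span {a, b}" "dot a v = 0" "dot b v = 0"
  shows "dot c v = 0"
proof -
  have "vec.subspace {c. dot c v = 0}"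
    by (auto simp: vec.subspace_def dot_add_left dot_scale_left)
  then have "vec.span {a, b} \<subseteq> {c. dot c v = 0}"
    by (rule vec.span_minimal[rotated]) (use assms in auto)
  then show ?thesis
    using assms by blast
qed

text \<open>A point of \<open>U\<close> outside the kernel of \<open>a\<close> lies on exactly one
  hyperplane \<open>b + c *s a\<close>, the one with \<open>c = - (dot b u / dot a u)\<close>. A
  common zero of \<open>a\<close> and \<open>b\<close> lies on all of them, and any other zero of
  \<open>a\<close> on none.\<close>

lemma card_pencil:
  fixes U :: "('a::{field,finite} ^ 'k) set"
  shows "card U + CARD('a) * card {u \<in> U. dot a u = 0 \<and> dot b u = 0}
    = card {u \<in> U. dot a u = 0} + (\<Sum>c\<in>UNIV. card {u \<in> U. dot (b + c *s a) u = 0})"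
proof -
  let ?W = "{u \<in> U. dot a u = 0 \<and> dot b u = 0}"
  let ?V = "\<lambda>c. {u \<in> U. dot a u \<noteq> 0 \<and> dot b u + c * dot a u = 0}"
  have "{u \<in> U. dot (b + c *s a) u = 0} = ?W \<union> ?V c" for c
    by (auto simp: dot_add_left dot_scale_left)
  then have "card {u \<in> U. dot (b + c *s a) u = 0} = card ?W + card (?V c)" for c
    by (subst card_Un_disjoint[symmetric]) auto
  then have "(\<Sum>c\<in>UNIV. card {u \<in> U. dot (b + c *s a) u = 0})
      = CARD('a) * card ?W + (\<Sum>c\<in>UNIV. card (?V c))"
    by (simp add: sum.distrib)
  also have "(\<Sum>c\<in>UNIV. card (?V c)) = card (\<Union>c. ?V c)"
  proof -
    have "c = d" if "u \<in> ?V c" "u \<in> ?V d" for c d u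
    proof -
      have "(c - d) * dot a u = (dot b u + c * dot a u) - (dot b u + d * dot a u)"
        by (simp add: algebra_simps)
      also have "\<dots> = 0"
        using that by simp
      finally show ?thesis
        using that by simp
    qed
    then have "\<forall>c\<in>UNIV. \<forall>d\<in>UNIV. c \<noteq> d \<longrightarrow> ?V c \<inter> ?V d = {}"
      by blast
    then show ?thesis
      by (simp add: card_UN_disjoint)
  qed
  also have "(\<Union>c. ?V c) = {u \<in> U. dot a u \<noteq> 0}"
  proof -
    have "u \<in> (\<Union>c. ?V c)" if "u \<in> U" "dot a u \<noteq> 0" for u
      using that by (intro UN_I[of "- (dot b u / dot a u)"]) auto
    then show ?thesis by blast
  qed
  finally have "(\<Sum>c\<in>UNIV. card {u \<in> U. dot (b + c *s a) u = 0})
      = CARD('a) * card ?W + card {u \<in> U. dot a u \<noteq> 0}" .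
  moreover have "card U = card {u \<in> U. dot a u = 0} + card {u \<in> U. dot a u \<noteq> 0}"
    by (subst card_Un_disjoint[symmetric]) (auto intro: arg_cong[where f = card])
  ultimately show ?thesis
    by simp
qed

text \<open>By the product formula for \<open>A + B\<close>, the inequality \<open>le\<close> says
  that \<open>A + B\<close> has at least as many elements as \<open>U\<close>, which contains it.
  Cancelling is possible because \<open>0 \<in> A \<inter> B\<close>.\<close>

lemma two_spannableI:
  fixes U :: "('a::{field,finite} ^ 'k) set"
  assumes "0 \<in> U" and add: "\<And>x y. x \<in> U \<Longrightarrow> y \<in> U \<Longrightarrow> x + y \<in> U"
    and diff: "\<And>x y. x \<in> U \<Longrightarrow> y \<in> U \<Longrightarrow> x - y \<in> U"
    and "a \<noteq> 0" "b \<noteq> 0"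
    and le: "card U * card {u \<in> U. dot a u = 0 \<and> dot b u = 0}
      \<le> card {u \<in> U. dot a u = 0} * card {u \<in> U. dot b u = 0}"
  shows "two_spannable U"
proof -
  define A B where "A = {u. dot a u = 0} \<inter> U" and "B = {u. dot b u = 0} \<inter> U"
  have AB: "A = {u \<in> U. dot a u = 0}" "B = {u \<in> U. dot b u = 0}"
    "A \<inter> B = {u \<in> U. dot a u = 0 \<and> dot b u = 0}"
    by (auto simp: A_def B_def)
  have "card (A + B) * card (A \<inter> B) = card A * card B"
    by (rule card_set_plus_times_card_Int) (auto simp: A_def B_def dot_diff_right diff)
  then have "card U * card (A \<inter> B) \<le> card (A + B) * card (A \<inter> B)"
    using le unfolding AB(3) by (simp add: AB(1,2))
  moreover have "0 \<in> A \<inter> B"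
    using assms(1) by (simp add: A_def B_def)
  then have "card (A \<inter> B) > 0"
    by (auto simp only: card_gt_0_iff finite)
  ultimately have "card U \<le> card (A + B)"
    by simp
  moreover have "A + B \<subseteq> U"
    by (auto simp: A_def B_def set_plus_def add)
  ultimately have "U = A + B"
    by (metis card_seteq finite)
  then show ?thesis
    unfolding two_spannable_def A_def B_def using assms(4,5) linear_hyperplane_dot by blast
qed

section \<open>The extremal pair of forms and the final count\<close>

theorem theorem4p7:
  fixes \<iota> :: "'f::{field,finite} \<Rightarrow> 'a::{field,finite}"
    and U :: "('a ^ 'k) set"
    and q m n k :: nat
  assumes "primepow q" and "m > 0" and "n > 0"
    and "k \<ge> 2"
    and "CARD('f) = q" and "CARD('a) = q ^ m"
    and "field_embedding \<iota>"
    and "rank_metric_system \<iota> n k U"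
    and "int n > 2 * int m - 3"
  shows "two_spannable U"
proof -
  interpret F: vector_space "restricted_scale \<iota> :: 'f \<Rightarrow> 'a ^ 'k \<Rightarrow> 'a ^ 'k"
    by (rule vector_space_restricted_scale) fact
  have k: "CARD('k) \<ge> 2" and U: "F.subspace U" and dimU: "F.dim U = n"
    using assms by (auto simp: rank_metric_system_def)
  have q: "q \<ge> 2"
    using \<open>primepow q\<close> primepow_gt_Suc_0[of q] by simp
  define Q N where "Q = q ^ m" and "N = q ^ n"
  define h where "h = (\<lambda>a. card {u \<in> U. dot a u = 0})"
  define w where "w = (\<lambda>a b. card {u \<in> U. dot a u = 0 \<and> dot b u = 0})"
  have Q: "CARD('a) = Q" and Qpos: "Q > 0"
    using assms q by (auto simp: Q_def)
  have N: "card U = N"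
    using F.card_subspace[of U] U dimU assms by (simp add: N_def)
  have h_power: "\<exists>i. h a = q ^ i" for a
  proof -
    have "F.subspace {u \<in> U. dot a u = 0}"
      using U by (auto simp: F.subspace_def restricted_scale_def dot_add_right dot_scale_right)
    then show ?thesis
      using F.card_subspace[of "{u \<in> U. dot a u = 0}"] assms by (auto simp: h_def)
  qed
  have h_ge: "N \<le> h a * Q" for a
  proof -
    have "N = h a * card (dot a ` U)"
      unfolding h_def N[symmetric]
      by (rule card_eq_card_kernel_times_card_image) (auto simp: F.subspace_diff U dot_add_right)
    also have "card (dot a ` U) \<le> Q"
      unfolding Q[symmetric] by (rule card_mono) auto
    finally show ?thesis by simp
  qed

  obtain a\<^sub>0 b\<^sub>0 where w0: "(w a\<^sub>0 b\<^sub>0 - 1) * Q\<^sup>2 \<le> N - 1"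
    using ex_two_forms_with_few_zeros[OF F.subspace_0[OF U]] unfolding w_def Q N by blast
  have w0_le: "w a\<^sub>0 b\<^sub>0 * Q\<^sup>2 \<le> N * q\<^sup>2"
  \<comment> \<open>For a count of at least 2, dropping the \<open>- 1\<close> costs a factor of at
    most 2, which \<open>q\<^sup>2\<close> absorbs. Otherwise the count is at most 1 and
    \<open>w0\<close> gives nothing; the bound is then \<open>2 * m \<le> n + 2\<close>, which is
    the hypothesis on \<open>n\<close>.\<close>
  proof (cases "w a\<^sub>0 b\<^sub>0 \<ge> 2")
    case True
    then have "w a\<^sub>0 b\<^sub>0 * Q\<^sup>2 \<le> (2 * (w a\<^sub>0 b\<^sub>0 - 1)) * Q\<^sup>2"
      by (intro mult_right_mono) auto
    also have "\<dots> \<le> 2 * N"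
      using w0 by simp
    also have "\<dots> \<le> N * q\<^sup>2"
      using q power_mono[of 2 q 2] by simp
    finally show ?thesis .
  next
    case False
    then have "w a\<^sub>0 b\<^sub>0 * Q\<^sup>2 \<le> 1 * Q\<^sup>2"
      by (intro mult_right_mono) auto
    also have "\<dots> = q ^ (2 * m)"
      by (simp add: Q_def power_mult[symmetric] mult.commute)
    also have "\<dots> \<le> q ^ (n + 2)"
      using assms q by (intro power_increasing) auto
    finally show ?thesis
      by (simp only: N_def power_add)
  qed

  \<comment> \<open>Only the first form of a pair enters the maximisation. Membership depends only
    on independence and the span, so \<open>(b + c *s a, a)\<close> is again a competitor of
    \<open>(a, b)\<close>; this is what yields \<open>h_max\<close>.\<close>
  define P where "P = {(a, b). a \<noteq> 0 \<and> b \<notin> vec.span {a} \<and>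
    a\<^sub>0 \<in> vec.span {a, b} \<and> b\<^sub>0 \<in> vec.span {a, b}}"
  have "P \<noteq> {}"
    by (rule ex_independent_pair_spanning[OF k, of a\<^sub>0 b\<^sub>0]) (unfold P_def, blast)
  then have "Max ((\<lambda>p. h (fst p)) ` P) \<in> (\<lambda>p. h (fst p)) ` P"
    by (intro Max_in) auto
  then obtain p where "p \<in> P" and Max: "Max ((\<lambda>p. h (fst p)) ` P) = h (fst p)"
    by blast
  have p_max: "h (fst p') \<le> h (fst p)" if "p' \<in> P" for p'
    unfolding Max[symmetric] using that by (intro Max_ge) auto
  obtain a b where ab: "p = (a, b)"
    by fastforce
  have a: "a \<noteq> 0" and b: "b \<notin> vec.span {a}"
    and ab0: "a\<^sub>0 \<in> vec.span {a, b}" "b\<^sub>0 \<in> vec.span {a, b}"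
    using \<open>p \<in> P\<close> by (auto simp: ab P_def)
  have bc: "b + c *s a \<noteq> 0" for c
  proof
    assume "b + c *s a = 0"
    then have "b = (- c) *s a"
      by (simp add: add_eq_0_iff2)
    then show False
      using b by (metis vec.span_base vec.span_scale singletonI)
  qed
  have h_max: "h (b + c *s a) \<le> h a" for c
  proof -
    let ?b = "b + c *s a"
    have "a \<notin> vec.span {?b}"
    proof
      assume "a \<in> vec.span {?b}"
      then obtain d where d: "a = d *s ?b"
        by (auto simp: vec.span_singleton)
      have "d \<noteq> 0"
        using a by (subst (asm) d) auto
      then have "inverse d *s (d *s ?b) = ?b"
        by simp
      then have "inverse d *s a = ?b"
        by (simp only: d[symmetric])
      then have "b = (inverse d - c) *s a"
        by (simp add: vec.scale_left_diff_distrib)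
      then show False
        using b by (metis vec.span_base vec.span_scale singletonI)
    qed
    moreover have "vec.span {a, b} \<subseteq> vec.span {?b, a}"
    proof (rule vec.span_minimal)
      have "?b - c *s a \<in> vec.span {?b, a}"
        by (intro vec.span_diff vec.span_scale vec.span_base) auto
      then show "{a, b} \<subseteq> vec.span {?b, a}"
        by (simp add: vec.span_base)
    qed simp
    ultimately have "(?b, a) \<in> P"
      using bc ab0 by (auto simp: P_def)
    then show ?thesis
      using p_max[of "(?b, a)"] by (simp add: ab)
  qed
  \<comment> \<open>Every common zero of \<open>a\<close> and \<open>b\<close> annihilates their
    span, hence \<open>a\<^sub>0\<close> and \<open>b\<^sub>0\<close>.\<close>
  have "w a b \<le> w a\<^sub>0 b\<^sub>0"
    unfolding w_def using dot_eq_0_of_span ab0 by (intro card_mono) auto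
  then have w_le: "w a b * Q\<^sup>2 \<le> N * q\<^sup>2"
    using w0_le by (meson le_trans mult_le_mono1)

  have "\<exists>c. N * w a b \<le> h a * h (b + c *s a)"
  proof (cases "\<exists>c. N * q \<le> h (b + c *s a) * Q")
    case True
    then obtain c where c: "N * q \<le> h (b + c *s a) * Q"
      by blast
    then have "N * q \<le> h a * Q"
      using h_max[of c] by (meson le_trans mult_le_mono1)
    have "N * w a b * Q\<^sup>2 \<le> N * (N * q\<^sup>2)"
      using mult_le_mono2[OF w_le, of N] by (simp add: mult.assoc)
    also have "\<dots> = (N * q) * (N * q)"
      by (simp add: power2_eq_square)
    also have "\<dots> \<le> (h a * Q) * (h (b + c *s a) * Q)"
      using \<open>N * q \<le> h a * Q\<close> c by (rule mult_le_mono)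
    also have "\<dots> = h a * h (b + c *s a) * Q\<^sup>2"
      by (simp add: power2_eq_square)
    finally show ?thesis
      using Qpos by auto
  next
    case False
    have "h (b + c *s a) * Q \<le> N" for c
    proof -
      obtain i where i: "h (b + c *s a) = q ^ i"
        using h_power by blast
      \<comment> \<open>Powers of \<open>q\<close> leave no room between \<open>N\<close> and
        \<open>N * q\<close>: being strictly below \<open>q ^ Suc n\<close> forces an exponent of at
        most \<open>n\<close>.\<close>
      have "q ^ (i + m) < q ^ Suc n"
        using False[simplified, rule_format, of c] by (simp add: i Q_def N_def power_add mult.commute)
      then have "i + m < Suc n"
        using q by (simp add: power_strict_increasing_iff del: power_Suc)
      then have "q ^ (i + m) \<le> q ^ n"
        using q by (intro power_increasing) auto
      then show ?thesis
        by (simp add: i Q_def N_def power_add)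
    qed
    then have "(\<Sum>c\<in>UNIV. h (b + c *s a) * Q) \<le> (\<Sum>c::'a\<in>UNIV. N)"
      by (intro sum_mono) auto
    then have "(\<Sum>c\<in>UNIV. h (b + c *s a)) * Q \<le> N * Q"
      unfolding sum_distrib_right by (simp add: Q mult.commute[of N])
    then have "(\<Sum>c\<in>UNIV. h (b + c *s a)) \<le> N"
      using Qpos by (simp only: mult_le_cancel2)
    \<comment> \<open>In the pencil identity the sum over \<open>c\<close> is at most
      \<open>N\<close>, so it cancels against the term \<open>card U\<close>.\<close>
    then have "Q * w a b \<le> h a"
      using card_pencil[of U a b] by (simp add: Q N h_def w_def)
    \<comment> \<open>Any \<open>c\<close> would serve here, since \<open>h_ge\<close> bounds every
      member of the pencil from below; \<open>c = 0\<close> is taken.\<close>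
    then have "h (b + 0 *s a) * (Q * w a b) \<le> h (b + 0 *s a) * h a"
      by (rule mult_le_mono2)
    moreover have "N * w a b \<le> h (b + 0 *s a) * Q * w a b"
      using h_ge by (rule mult_le_mono1)
    ultimately have "N * w a b \<le> h a * h (b + 0 *s a)"
      unfolding mult.assoc mult.commute[of "h a"] by (rule le_trans[rotated])
    then show ?thesis
      by blast
  qed
  then obtain c where c: "N * w a b \<le> h a * h (b + c *s a)"
    by blast
  \<comment> \<open>Replacing \<open>b\<close> by \<open>b + c *s a\<close> leaves the common kernel
    with \<open>a\<close> unchanged, so the count fits the chosen pair of hyperplanes.\<close>
  have "w a b = card {u \<in> U. dot a u = 0 \<and> dot (b + c *s a) u = 0}"
    unfolding w_def by (rule arg_cong[where f = card]) (auto simp: dot_add_left dot_scale_left)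
  then show ?thesis
    using c a bc
    by (intro two_spannableI[of U a "b + c *s a"])
      (auto simp: F.subspace_0 F.subspace_add F.subspace_diff U N h_def)
qed

end
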